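(* Let $N\ge 1$ and let $\chi=\{x_1,\dots,x_M\}\subset\mathbb{C}\setminus\{0\}$, $M\ge 2$, be a (not necessarily unit-modulus) $M$-QAM constellation. Let $\epsilon_m\in(0,1)$, $N_{s,d}>0$, $N_{r_m,d}>0$, and let the previous symbols $x[n-1]\in\chi$ and $x_m[n-1]\in\chi$ be given, $m=1,\dots,N$. Let $y_{s,d}[n-1],y_{s,d}[n],y_{r_m,d}[n-1],y_{r_m,d}[n]\in\mathbb{C}$ be given observations, and for $x\in\chi$ let $p(x)$ be the joint conditional likelihood of $(y_{s,d}[n],y_{r_1,d}[n],\dots,y_{r_N,d}[n])$ given the previous observations, the previous symbols and $x[n]=x$, as defined in the context. Then the set of maximizers of $p(x)$ over $x\in\chi$ (the maximum likelihood decisions) coincides with $$\arg\max_{x\in\chi}\Bigg\{-\ln\Big(1+\tfrac{|x|^2}{|x[n-1]|^2}\Big)-\frac{\big|y_{s,d}[n]-y_{s,d}[n-1]\frac{x}{|x[n-1]|}\big|^2}{\big(1+\frac{|x|^2}{|x[n-1]|^2}\big)N_{s,d}}+\sum_{m=1}^{N}\ln\Big((1-\epsilon_m)E_m(x)+\frac{\epsilon_m}{M-1}\sum_{i:\,x_i\ne x}E_m(x_i)\Big)\Bigg\},$$ where $$E_m(x)=\frac{1}{1+\frac{|x|^2}{|x_m[n-1]|^2}}\exp\left(-\frac{\big|y_{r_m,d}[n]-y_{r_m,d}[n-1]\frac{x}{|x_m[n-1]|}\big|^2}{\big(1+\frac{|x|^2}{|x_m[n-1]|^2}\big)N_{r_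m,d}}\right).$$
   Context: $\mathcal{CN}(\mu,\eta)$ denotes the circular complex Gaussian law with density $z\mapsto\frac{1}{\pi\eta}e^{-|z-\mu|^2/\eta}$ on $\mathbb{C}$. Model (differential decode-and-forward cooperation with $N$ relays, differential encoding $v[n]=v[n-1]x[n]/|x[n-1]|$). The source sends the data symbol $x[n]\in\chi$. Relay $m$ demodulates it to $x_m[n]\in\chi$, with $x_m[n]=x[n]$ with probability $1-\epsilon_m$ and $x_m[n]$ equal to each of the $M-1$ other constellation points with probability $\epsilon_m/(M-1)$, and retransmits it to the destination. Conditionally on the previous received samples and on the sent current and previous symbols, the destination treats the signals as independent with laws $$y_{s,d}[n]\sim\mathcal{CN}\Big(y_{s,d}[n-1]\tfrac{x[n]}{|x[n-1]|},\,\big(1+\tfrac{|x[n]|^2}{|x[n-1]|^2}\big)N_{s,d}\Big),\quad y_{r_m,d}[n]\sim\mathcal{CN}\Big(y_{r_m,d}[n-1]\tfrac{x_m[n]}{|x_m[n-1]|},\,\big(1+\tfrac{|x_m[n]|^2}{|x_m[n-1]|^2}\big)N_{r_m,d}\Big).$$ Accordingly $p(x)=\phi_0(x)\prod_{m=1}^N\big[(1-\epsilon_m)\phi_m(x)+\frac{\epsilon_m}{M-1}\sum_{i:\,x_i\ne x}\phi_m(x_i)\big]$, where $\phi_0(x)$ is the density of the law $\mathcal{CN}\big(y_{s,d}[n-1]\tfrac{x}{|x[n-1]|},\,(1+\tfrac{|x|^2}{|x[n-1]|^2})N_{s,d}\big)$ evaluated at the observed value $y_{s,d}[n]$, and $\phi_m(x)$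 is the density of the law $\mathcal{CN}\big(y_{r_m,d}[n-1]\tfrac{x}{|x_m[n-1]|},\,(1+\tfrac{|x|^2}{|x_m[n-1]|^2})N_{r_m,d}\big)$ evaluated at the observed value $y_{r_m,d}[n]$. *)

theory Defs
  imports Complex_Main
begin

definition argmax_on :: "'a set \<Rightarrow> ('a \<Rightarrow> real) \<Rightarrow> 'a set" where
  "argmax_on S f = {x. is_arg_max f (\<lambda>x. x \<in> S) x}"

text \<open>The density of \<open>CN(\<mu>, \<eta>)\<close> with respect to Lebesgue measure on the complex plane, at \<open>z\<close>;
  \<open>\<eta>\<close> is the total variance, i.e. \<open>\<eta> / 2\<close> per real dimension.\<close>

definition cn_density :: "complex \<Rightarrow> real \<Rightarrow> complex \<Rightarrow> real" where
  "cn_density \<mu> \<eta> z = 1 / (pi * \<eta>) * exp (- (cmod (z - \<mu>))\<^sup>2 / \<eta>)"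

text \<open>One differentially encoded link with noise variance \<open>N0\<close>, previous symbol \<open>xp\<close>, and previous
  and current received samples \<open>yp\<close>, \<open>y\<close>, as a function of the current symbol \<open>x\<close>.\<close>

definition noise_factor :: "complex \<Rightarrow> complex \<Rightarrow> real" where
  "noise_factor xp x = 1 + (cmod x)\<^sup>2 / (cmod xp)\<^sup>2"

definition link_density :: "real \<Rightarrow> complex \<Rightarrow> complex \<Rightarrow> complex \<Rightarrow> complex \<Rightarrow> real" where
  "link_density N0 xp yp y x =
     cn_density (yp * (x / of_real (cmod xp))) (noise_factor xp x * N0) y"

text \<open>Averaging over the symbol retransmitted by a relay: the true symbol \<open>x\<close> with probability
  \<open>1 - \<epsilon>\<close>, each other point of the constellation with probability \<open>\<epsilon> / (M - 1)\<close>.\<close>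

definition relay_average :: "complex set \<Rightarrow> real \<Rightarrow> (complex \<Rightarrow> real) \<Rightarrow> complex \<Rightarrow> real" where
  "relay_average \<chi> \<epsilon> f x =
     (1 - \<epsilon>) * f x + \<epsilon> / (real (card \<chi>) - 1) * (\<Sum>x' \<in> \<chi> - {x}. f x')"

text \<open>The joint conditional likelihood \<open>p(x)\<close>. Suffix \<open>sd\<close> is the source-destination link,
  \<open>rd m\<close> the link from relay \<open>m\<close> to the destination; \<open>xs\<close>, \<open>xr m\<close> are the previous symbols of the
  source and of relay \<open>m\<close>; \<open>yp_\<close> and \<open>y_\<close> are the previous and the current received samples.\<close>

definition likelihood ::
  "complex set \<Rightarrow> nat \<Rightarrow> (nat \<Rightarrow> real) \<Rightarrow> real \<Rightarrow> (nat \<Rightarrow> real) \<Rightarrow>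
   complex \<Rightarrow> (nat \<Rightarrow> complex) \<Rightarrow> complex \<Rightarrow> complex \<Rightarrow> (nat \<Rightarrow> complex) \<Rightarrow> (nat \<Rightarrow> complex) \<Rightarrow>
   complex \<Rightarrow> real" where
  "likelihood \<chi> N \<epsilon> N_sd N_rd xs xr yp_sd y_sd yp_rd y_rd x =
     link_density N_sd xs yp_sd y_sd x *
     (\<Prod>m = 1..N. relay_average \<chi> (\<epsilon> m) (link_density (N_rd m) (xr m) (yp_rd m) (y_rd m)) x)"

text \<open>The quantity \<open>E_m(x)\<close>.\<close>

definition relay_E :: "real \<Rightarrow> complex \<Rightarrow> complex \<Rightarrow> complex \<Rightarrow> complex \<Rightarrow> real" where
  "relay_E N0 xp yp y x =
     1 / (1 + (cmod x)\<^sup>2 / (cmod xp)\<^sup>2) *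
     exp (- (cmod (y - yp * (x / of_real (cmod xp))))\<^sup>2
            / ((1 + (cmod x)\<^sup>2 / (cmod xp)\<^sup>2) * N0))"

end

(* Pulling the factor 1 / (pi * N0) out of every link density leaves relay_E, so the likelihood is a
  positive constant times a product of positive terms in relay_E, and the objective is its logarithm
  up to an additive constant. *)

theory Submission
  imports Defs
begin

text \<open>\<open>is_arg_max\<close> refers to the objective only through strict comparisons
  between members of \<open>S\<close>, so two objectives that order \<open>S\<close> alike have the
  same maximizers.\<close>

lemma argmax_on_cong_less:
  assumes "\<And>x y. x \<in> S \<Longrightarrow> y \<in> S \<Longrightarrow> f x < f y \<longleftrightarrow> g x < g y"
  shows "argmax_on S f = argmax_on S g"
  using assms unfolding argmax_on_def is_arg_max_def by blast

text \<open>\<open>ln\<close> is strictly increasing on the positive reals, and the constant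
  \<open>c\<close> cancels in every comparison. The constant is there to absorb the normalising
  factors of the densities.\<close>

lemma argmax_on_ln:
  assumes "\<And>x. x \<in> S \<Longrightarrow> 0 < f x"
    and "\<And>x. x \<in> S \<Longrightarrow> ln (f x) = c + g x"
  shows "argmax_on S f = argmax_on S g"
proof (rule argmax_on_cong_less)
  fix x y assume "x \<in> S" "y \<in> S"
  then have "f x < f y \<longleftrightarrow> ln (f x) < ln (f y)"
    using assms(1) by simp
  then show "f x < f y \<longleftrightarrow> g x < g y"
    using assms(2) \<open>x \<in> S\<close> \<open>y \<in> S\<close> by simp
qed

lemma noise_factor_pos: "0 < 1 + (cmod x)\<^sup>2 / (cmod xp)\<^sup>2"
  by (simp add: add_pos_nonneg)

lemma relay_E_pos: "0 < relay_E N0 xp yp y x"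
  unfolding relay_E_def using noise_factor_pos by simp

lemma ln_relay_E:
  "ln (relay_E N0 xp yp y x) =
     - ln (1 + (cmod x)\<^sup>2 / (cmod xp)\<^sup>2)
     - (cmod (y - yp * (x / of_real (cmod xp))))\<^sup>2 / ((1 + (cmod x)\<^sup>2 / (cmod xp)\<^sup>2) * N0)"
  unfolding relay_E_def using noise_factor_pos[of x xp] by (simp add: ln_mult_pos ln_div)

text \<open>Of the normalisation \<open>1 / (pi * \<eta>)\<close>, only the noise factor in
  \<open>\<eta>\<close> varies with \<open>x\<close>; it stays inside
  \<open>relay_E\<close>.\<close>

lemma link_density_eq: "link_density N0 xp yp y x = 1 / (pi * N0) * relay_E N0 xp yp y x"
  by (simp add: link_density_def cn_density_def noise_factor_def relay_E_def)

text \<open>The average is linear in \<open>f\<close>. A factor common to all constellation points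
  can therefore leave the mixture.\<close>

lemma relay_average_scale:
  "relay_average \<chi> \<epsilon> (\<lambda>x. c * f x) x = c * relay_average \<chi> \<epsilon> f x"
  by (simp add: relay_average_def sum_distrib_left[symmetric] algebra_simps)

text \<open>The term of the correct symbol is strictly positive because
  \<open>\<epsilon> < 1\<close>; the terms of the wrong symbols only add something
  nonnegative.\<close>

lemma relay_average_pos:
  assumes "0 \<le> \<epsilon>" "\<epsilon> < 1" "1 \<le> card \<chi>" "\<And>x. 0 < f x"
  shows "0 < relay_average \<chi> \<epsilon> f x"
  unfolding relay_average_def using assms
  by (intro add_pos_nonneg mult_pos_pos mult_nonneg_nonneg sum_nonneg divide_nonneg_nonneg)
     (auto simp: less_imp_le)

lemma likelihood_eq:
  "likelihood \<chi> N \<epsilon> N_sd N_rd xs xr yp_sd y_sd yp_rd y_rd x =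
     (1 / (pi * N_sd) * (\<Prod>m = 1..N. 1 / (pi * N_rd m))) *
     (relay_E N_sd xs yp_sd y_sd x *
      (\<Prod>m = 1..N. relay_average \<chi> (\<epsilon> m) (relay_E (N_rd m) (xr m) (yp_rd m) (y_rd m)) x))"
proof -
  \<comment> \<open>\<open>relay_average\<close> takes the density as a function, so the
    factorisation is restated for functions, in the shape that \<open>relay_average_scale\<close>
    rewrites.\<close>
  have "link_density (N_rd m) (xr m) (yp_rd m) (y_rd m) =
      (\<lambda>x. 1 / (pi * N_rd m) * relay_E (N_rd m) (xr m) (yp_rd m) (y_rd m) x)" for m
    by (rule ext) (rule link_density_eq)
  then show ?thesis
    unfolding likelihood_def by (simp only: relay_average_scale prod.distrib link_density_eq mult_ac)
qed

theorem mainTheorem2: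
  fixes \<chi> :: "complex set" and M N :: nat
    and \<epsilon> :: "nat \<Rightarrow> real" and N_sd :: real and N_rd :: "nat \<Rightarrow> real"
    and xs :: complex and xr :: "nat \<Rightarrow> complex"
    and yp_sd y_sd :: complex and yp_rd y_rd :: "nat \<Rightarrow> complex"
  assumes "N \<ge> 1"
    and "finite \<chi>" and "card \<chi> = M" and "M \<ge> 2" and "0 \<notin> \<chi>"
    and "\<And>m. m \<in> {1..N} \<Longrightarrow> 0 < \<epsilon> m \<and> \<epsilon> m < 1"
    and "N_sd > 0" and "\<And>m. m \<in> {1..N} \<Longrightarrow> N_rd m > 0"
    and "xs \<in> \<chi>" and "\<And>m. m \<in> {1..N} \<Longrightarrow> xr m \<in> \<chi>"
  shows "argmax_on \<chi> (likelihood \<chi> N \<epsilon> N_sd N_rd xs xr yp_sd y_sd yp_rd y_rd) =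
    argmax_on \<chi> (\<lambda>x.
      - ln (1 + (cmod x)\<^sup>2 / (cmod xs)\<^sup>2)
      - (cmod (y_sd - yp_sd * (x / of_real (cmod xs))))\<^sup>2
          / ((1 + (cmod x)\<^sup>2 / (cmod xs)\<^sup>2) * N_sd)
      + (\<Sum>m = 1..N. ln (
          (1 - \<epsilon> m) * relay_E (N_rd m) (xr m) (yp_rd m) (y_rd m) x
          + \<epsilon> m / (real M - 1) *
            (\<Sum>x' \<in> \<chi> - {x}. relay_E (N_rd m) (xr m) (yp_rd m) (y_rd m) x'))))"
proof (rule argmax_on_ln)
  \<comment> \<open>\<open>A m x\<close> is the argument of the \<open>m\<close>-th logarithm in the
    objective, and \<open>K\<close> collects all factors that do not depend on
    \<open>x\<close>.\<close>
  define A where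
    "A m x = relay_average \<chi> (\<epsilon> m) (relay_E (N_rd m) (xr m) (yp_rd m) (y_rd m)) x" for m x
  define K where "K = 1 / (pi * N_sd) * (\<Prod>m = 1..N. 1 / (pi * N_rd m))"
  have A_pos: "0 < A m x" if "m \<in> {1..N}" for m x
    unfolding A_def using assms(3,4) assms(6)[OF that]
    by (intro relay_average_pos relay_E_pos) auto
  have K_pos: "0 < K"
    unfolding K_def using assms(7,8) by (intro mult_pos_pos prod_pos) auto
  have prod_A_pos: "0 < (\<Prod>m = 1..N. A m x)" for x
    using A_pos by (intro prod_pos) auto
  note E_pos = relay_E_pos[of N_sd xs yp_sd y_sd]
  have eq: "likelihood \<chi> N \<epsilon> N_sd N_rd xs xr yp_sd y_sd yp_rd y_rd x =
      K * (relay_E N_sd xs yp_sd y_sd x * (\<Prod>m = 1..N. A m x))" for x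
    unfolding K_def A_def by (rule likelihood_eq)
  fix x
  show "0 < likelihood \<chi> N \<epsilon> N_sd N_rd xs xr yp_sd y_sd yp_rd y_rd x"
    unfolding eq using K_pos E_pos prod_A_pos by simp
  have "ln (\<Prod>m = 1..N. A m x) = (\<Sum>m = 1..N. ln (A m x))"
    using A_pos by (intro ln_prod) (auto simp: less_imp_neq[symmetric])
  \<comment> \<open>The constant \<open>c\<close> left open by \<open>argmax_on_ln\<close> becomes
    \<open>ln K\<close>. Replacing \<open>card \<chi>\<close> by \<open>M\<close> turns
    \<open>A m x\<close> into the mixture written in the objective.\<close>
  then show "ln (likelihood \<chi> N \<epsilon> N_sd N_rd xs xr yp_sd y_sd yp_rd y_rd x) = ln K + (
      - ln (1 + (cmod x)\<^sup>2 / (cmod xs)\<^sup>2)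
      - (cmod (y_sd - yp_sd * (x / of_real (cmod xs))))\<^sup>2
          / ((1 + (cmod x)\<^sup>2 / (cmod xs)\<^sup>2) * N_sd)
      + (\<Sum>m = 1..N. ln (
          (1 - \<epsilon> m) * relay_E (N_rd m) (xr m) (yp_rd m) (y_rd m) x
          + \<epsilon> m / (real M - 1) *
            (\<Sum>x' \<in> \<chi> - {x}. relay_E (N_rd m) (xr m) (yp_rd m) (y_rd m) x'))))"
    using K_pos E_pos[of x] prod_A_pos[of x] assms(3)
    by (simp add: eq ln_mult_pos ln_relay_E A_def relay_average_def)
qed

end
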